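(* Let $\mathcal{F}$ be a class of distribution functions on $\mathbb{R}$ with finite first moments and unique quantiles. Let $\nu_\mu\colon\mathcal{F}\to\mathbb{R}$ be a spectral risk measure. If the support of $\mu$ is finite with $L$ elements and contained in $(0,1]$, then $\nu_\mu$ is a component of a $k$-elicitable functional where (i) $k=1$, if $\mu$ is concentrated at $1$, meaning $\mu(\{1\})=1$; (ii) $k=1+L$, if $\mu(\{1\})<1$.
   Context: For a distribution function $F$ on $\mathbb{R}$, $F^{-1}(\alpha):=\inf\{x\in\mathbb{R}\colon F(x)\ge\alpha\}$, $\operatorname{VaR}_\alpha(F):=F^{-1}(\alpha)$, and $\operatorname{ES}_\alpha(F):=\frac1\alpha\int_0^\alpha\operatorname{VaR}_u(F)\,\mathrm{d}u$ for $\alpha\in(0,1]$. For a probability measure $\mu$ on $[0,1]$ with support in $(0,1]$ (the spectral measure), the spectral risk measure associated to $\mu$ is $\nu_\mu(F):=\int_{[0,1]}\operatorname{ES}_\alpha(F)\,\mu(\mathrm{d}\alpha)$. For $\mathsf{A}\subseteq\mathbb{R}^k$, a function $T\colon\mathcal{F}\to\mathsf{A}$ is called a functional. A scoring function is a function $S\colon\mathsf{A}\times\mathbb{R}\to\mathbb{R}$ such that $S(x,\cdot)$ is $F$-integrable for all $x\in\mathsf{A}$, $F\in\mathcal{F}$; write $\bar S(x,F):=\int S(x,y)\,\mathrm{d}F(y)$. $S$ is strictly $\mathcal{F}$-consistent for $T$ if $\bar S(T(F),F)\le\bar S(x,F)$ for all $F\in\mathcal{F}$, $x\in\mathsf{A}$,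 with equality only if $x=T(F)$. $T\colon\mathcal{F}\to\mathsf{A}\subseteq\mathbb{R}^k$ is $k$-elicitable if a strictly $\mathcal{F}$-consistent scoring function for it exists. "$\nu_\mu$ is a component of a $k$-elicitable functional" means that there is a $k$-elicitable $T=(T_1,\dots,T_k)$ on $\mathcal{F}$ with $T_j=\nu_\mu$ for some $j$. *)

theory Defs
  imports "HOL-Probability.Probability"
begin

definition distribution_function :: "(real \<Rightarrow> real) \<Rightarrow> bool" where
  "distribution_function F \<longleftrightarrow>
     mono F \<and> (\<forall>a. continuous (at_right a) F) \<and>
     (F \<longlongrightarrow> 0) at_bot \<and> (F \<longlongrightarrow> 1) at_top"

text \<open>Integrals with respect to \<open>dF\<close> are integrals with respect to
  \<^term>\<open>interval_measure F\<close>.\<close>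

definition finite_first_moment :: "(real \<Rightarrow> real) \<Rightarrow> bool" where
  "finite_first_moment F \<longleftrightarrow> integrable (interval_measure F) (\<lambda>y. y)"

definition is_quantile :: "real \<Rightarrow> (real \<Rightarrow> real) \<Rightarrow> real \<Rightarrow> bool" where
  "is_quantile \<alpha> F x \<longleftrightarrow> Lim (at_left x) F \<le> \<alpha> \<and> \<alpha> \<le> F x"

definition unique_quantiles :: "(real \<Rightarrow> real) \<Rightarrow> bool" where
  "unique_quantiles F \<longleftrightarrow> (\<forall>\<alpha>\<in>{0<..<1}. \<exists>!x. is_quantile \<alpha> F x)"

text \<open>For \<open>\<alpha> = 0\<close> and possibly \<open>\<alpha> = 1\<close> the infimum is infinite, and its value in \<^typ>\<open>real\<close>
  is unspecified; these levels are never used below except as endpoints of an integral.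
  Likewise the value of \<open>ES\<close> at level \<open>0\<close> is irrelevant, as spectral measures give \<open>0\<close> no mass.\<close>

definition VaR :: "real \<Rightarrow> (real \<Rightarrow> real) \<Rightarrow> real" where
  "VaR \<alpha> F = Inf {x. F x \<ge> \<alpha>}"

definition ES :: "real \<Rightarrow> (real \<Rightarrow> real) \<Rightarrow> real" where
  "ES \<alpha> F = 1 / \<alpha> * (LBINT u=0..\<alpha>. VaR u F)"

definition msupport :: "'a::topological_space measure \<Rightarrow> 'a set" where
  "msupport \<mu> = {x \<in> space \<mu>. \<forall>U. open U \<and> x \<in> U \<longrightarrow> emeasure \<mu> (U \<inter> space \<mu>) > 0}"

definition spectral_measure :: "real measure \<Rightarrow> bool" where
  "spectral_measure \<mu> \<longleftrightarrow>
     prob_space \<mu> \<and> space \<mu> = {0..1} \<and> sets \<mu> = sets (restrict_space borel {0..1}) \<and>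
     msupport \<mu> \<subseteq> {0<..1}"

definition spectral_risk :: "real measure \<Rightarrow> (real \<Rightarrow> real) \<Rightarrow> real" where
  "spectral_risk \<mu> F = (LINT \<alpha>|\<mu>. ES \<alpha> F)"

text \<open>Vectors in \<open>\<real>\<^sup>k\<close> are functions on the index set \<^term>\<open>{..<k::nat}\<close>, extended by
  \<^term>\<open>undefined\<close>, so that equality of functions is equality of vectors.\<close>

abbreviation Rvec :: "nat \<Rightarrow> (nat \<Rightarrow> real) set" where
  "Rvec k \<equiv> {..<k} \<rightarrow>\<^sub>E UNIV"

definition scoring_function ::
    "'v set \<Rightarrow> (real \<Rightarrow> real) set \<Rightarrow> ('v \<Rightarrow> real \<Rightarrow> real) \<Rightarrow> bool" where
  "scoring_function A \<F> S \<longleftrightarrow> (\<forall>x\<in>A. \<forall>F\<in>\<F>. integrable (interval_measure F) (S x))"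

definition expected_score :: "('v \<Rightarrow> real \<Rightarrow> real) \<Rightarrow> 'v \<Rightarrow> (real \<Rightarrow> real) \<Rightarrow> real" where
  "expected_score S x F = (LINT y|interval_measure F. S x y)"

definition strictly_consistent ::
    "'v set \<Rightarrow> (real \<Rightarrow> real) set \<Rightarrow> ((real \<Rightarrow> real) \<Rightarrow> 'v) \<Rightarrow> ('v \<Rightarrow> real \<Rightarrow> real) \<Rightarrow> bool" where
  "strictly_consistent A \<F> T S \<longleftrightarrow>
     (\<forall>F\<in>\<F>. \<forall>x\<in>A. expected_score S (T F) F \<le> expected_score S x F \<and>
        (expected_score S (T F) F = expected_score S x F \<longrightarrow> x = T F))"

text \<open>The action domain \<open>A\<close> belongs to the functional \<open>T : \<F> \<rightarrow> A \<subseteq> \<real>\<^sup>k\<close>.\<close>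

definition elicitable ::
    "nat \<Rightarrow> (nat \<Rightarrow> real) set \<Rightarrow> (real \<Rightarrow> real) set \<Rightarrow> ((real \<Rightarrow> real) \<Rightarrow> nat \<Rightarrow> real) \<Rightarrow> bool" where
  "elicitable k A \<F> T \<longleftrightarrow>
     A \<subseteq> Rvec k \<and> T \<in> \<F> \<rightarrow> A \<and>
     (\<exists>S. scoring_function A \<F> S \<and> strictly_consistent A \<F> T S)"

definition component_of_elicitable ::
    "nat \<Rightarrow> (real \<Rightarrow> real) set \<Rightarrow> ((real \<Rightarrow> real) \<Rightarrow> real) \<Rightarrow> bool" where
  "component_of_elicitable k \<F> \<nu> \<longleftrightarrow>
     (\<exists>A T. elicitable k A \<F> T \<and> (\<exists>j<k. \<forall>F\<in>\<F>. T F j = \<nu> F))"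

end

(*
  For a level a < 1 the function x |-> E(x - (x - Y)^+ / a) attains its maximum, ES_a, exactly at the
  a-quantile, and ES_1 is the mean.  If the spectral measure has atoms q_i of mass w_i > 0, then
  g(x, Y) = sum_i w_i (x_i - (x_i - Y)^+ / q_i), with Y as the summand of an atom at 1, satisfies
  E g(x, Y) <= nu_mu, with equality only if every x_i with q_i < 1 is the q_i-quantile.
  Convexity of exp gives exp z (1 + E g - z) <= exp nu_mu with equality only if E g = nu_mu = z, so
  - exp z (1 + g - z) scores the quantiles together with nu_mu.  An atom at 1 occupies a component
  of its own, which holds the mean; it is scored by x^2 - 2 x y, which, unlike (x - y)^2, needs only
  a first moment.
*)
theory Submission
  imports Defs
begin

section \<open>Uniform levels on the unit interval\<close>

definition mean :: "(real \<Rightarrow> real) \<Rightarrow> real" where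
  "mean F = (LINT y|interval_measure F. y)"

text \<open>The endpoints are left out because the infimum defining \<open>VaR\<close> may be
  infinite there.\<close>

abbreviation unit_uniform :: "real measure" where
  "unit_uniform \<equiv> restrict_space lborel {0<..<1}"

lemma prob_space_unit_uniform: "prob_space unit_uniform"
  by (rule prob_spaceI) (simp add: space_restrict_space emeasure_restrict_space)

lemma measure_unit_uniform_lessThan:
  assumes "0 \<le> \<alpha>" "\<alpha> \<le> 1"
  shows "measure unit_uniform ({..<\<alpha>} \<inter> {0<..<1}) = \<alpha>"
proof -
  have "{..<\<alpha>} \<inter> {0<..<1} = {0<..<\<alpha>}"
    using assms by auto
  then have "measure unit_uniform ({..<\<alpha>} \<inter> {0<..<1}) = measure unit_uniform {0<..<\<alpha>}"
    by (rule arg_cong)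
  also have "\<dots> = measure lborel {0<..<\<alpha>}"
    using assms by (intro measure_restrict_space) auto
  also have "\<dots> = \<alpha>"
    using assms by simp
  finally show ?thesis .
qed

text \<open>A nonempty open interval has positive length, so it cannot miss a set of full measure.
  This later supplies a level strictly between two given ones at which an almost sure identity
  holds.\<close>

lemma AE_unit_uniform_Ioo:
  assumes "AE u in unit_uniform. P u" "a < b" "0 \<le> a" "b \<le> 1"
  obtains u where "u \<in> {a<..<b}" "P u"
proof -
  have "AE u in lborel. u \<in> {0<..<1} \<longrightarrow> P u"
    using assms(1) by (simp add: AE_restrict_space_iff)
  moreover have "\<not> (AE u in lborel. u \<notin> {a<..<b})"
    using assms(2) by (subst AE_iff_measurable[where N="{a<..<b}"]) auto
  then have "\<exists>u. u \<in> {a<..<b} \<and> P u"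
  proof (rule contrapos_np)
    assume "\<not> (\<exists>u. u \<in> {a<..<b} \<and> P u)"
    then have "u \<notin> {a<..<b}" if "u \<in> {0<..<1} \<longrightarrow> P u" for u
      using that assms(3,4) by auto
    with \<open>AE u in lborel. u \<in> {0<..<1} \<longrightarrow> P u\<close> show "AE u in lborel. u \<notin> {a<..<b}"
      by (auto elim: eventually_mono)
  qed
  then show ?thesis
    using that by blast
qed

section \<open>Quantile transform and expected shortfall as an integral over levels\<close>

locale dist_fun =
  fixes F :: "real \<Rightarrow> real"
  assumes distribution_function: "distribution_function F"
begin

lemma F_mono: "x \<le> y \<Longrightarrow> F x \<le> F y"
  using distribution_function by (auto simp: distribution_function_def mono_def)

lemma real_distribution_F: "real_distribution (interval_measure F)"
  using distribution_function F_mono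
  by (intro real_distribution_interval_measure) (auto simp: distribution_function_def)

lemma cdf_F: "cdf (interval_measure F) = F"
  using distribution_function F_mono
  by (intro cdf_interval_measure) (auto simp: distribution_function_def)

sublocale law: cdf_distribution "interval_measure F"
  by (rule cdf_distribution.intro, rule real_distribution_F)

lemma I_eq_VaR: "law.I u = VaR u F"
  by (simp add: VaR_def cdf_F)

lemma VaR_le_iff: "u \<in> {0<..<1} \<Longrightarrow> VaR u F \<le> x \<longleftrightarrow> u \<le> F x"
  using law.pseudoinverse[of u x] by (simp add: VaR_def cdf_F)

lemma VaR_mono: "u \<in> {0<..<1} \<Longrightarrow> v \<in> {0<..<1} \<Longrightarrow> u \<le> v \<Longrightarrow> VaR u F \<le> VaR v F"
  using law.mono_I[unfolded I_eq_VaR] by (auto simp: mono_on_def)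

lemma measurable_VaR [measurable]: "(\<lambda>u. VaR u F) \<in> borel_measurable unit_uniform"
  using law.measurable_CI[unfolded I_eq_VaR]
  by (simp cong: measurable_cong_sets add: sets_restrict_space)

text \<open>This turns expectations under the law of \<open>F\<close> into integrals over levels,
  the form in which \<open>ES\<close> is defined, so that scores and \<open>ES\<close> can be
  compared pointwise in \<open>u\<close>.\<close>

lemma distr_VaR: "distr unit_uniform borel (\<lambda>u. VaR u F) = interval_measure F"
  using law.distr_I_eq_M[unfolded I_eq_VaR] .

lemma integral_law:
  fixes g :: "real \<Rightarrow> real"
  assumes "g \<in> borel_measurable borel"
  shows "(LINT y|interval_measure F. g y) = (LINT u|unit_uniform. g (VaR u F))"
  using integral_distr[OF measurable_VaR assms] distr_VaR by simp

lemma integrable_law_iff: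
  fixes g :: "real \<Rightarrow> real"
  assumes "g \<in> borel_measurable borel"
  shows "integrable (interval_measure F) g \<longleftrightarrow> integrable unit_uniform (\<lambda>u. g (VaR u F))"
  using integrable_distr_eq[OF measurable_VaR assms] distr_VaR by simp

text \<open>The indicator moves \<alpha> from the domain into the integrand, so all levels share one
  measure. At \<alpha> = 0 both sides are 0, since division by zero gives 0.\<close>

lemma ES_eq:
  assumes "\<alpha> \<in> {0..1}"
  shows "ES \<alpha> F = 1 / \<alpha> * (LINT u|unit_uniform. indicator {..<\<alpha>} u * VaR u F)"
proof -
  have "(LBINT u=0..\<alpha>. VaR u F) = (LBINT u:{0<..<\<alpha>}. VaR u F)"
    using assms interval_integral_Ioo[of 0 "ereal \<alpha>" "\<lambda>u. VaR u F"] by (simp add: zero_ereal_def)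
  also have "\<dots> = (LINT u|unit_uniform. indicator {..<\<alpha>} u * VaR u F)"
    using assms unfolding set_lebesgue_integral_def
    by (subst integral_restrict_space)
       (auto intro!: Bochner_Integration.integral_cong split: split_indicator)
  finally show ?thesis by (simp add: ES_def)
qed

lemma ES_1: "ES 1 F = mean F"
proof -
  have "(LINT u|unit_uniform. indicator {..<1} u * VaR u F) = (LINT u|unit_uniform. VaR u F)"
    by (intro Bochner_Integration.integral_cong) (auto simp: space_restrict_space)
  then show ?thesis
    by (simp add: ES_eq mean_def integral_law)
qed

lemma measurable_ES: "(\<lambda>\<alpha>. ES \<alpha> F) \<in> borel_measurable (restrict_space borel {0..1})"
proof -
  interpret U: prob_space unit_uniform
    by (rule prob_space_unit_uniform)
  let ?N = "restrict_space borel {0..1::real}"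
  have [measurable]: "(\<lambda>\<alpha>. \<alpha>) \<in> borel_measurable ?N" "(\<lambda>u. u) \<in> borel_measurable unit_uniform"
    by (auto intro!: measurable_restrict_space1)
  \<comment> \<open>With \<open>if u < \<alpha>\<close> in place of the indicator, the integrand is
    visibly measurable in both variables jointly, so its integral over \<open>u\<close> is
    measurable in \<alpha>.\<close>
  have "case_prod (\<lambda>\<alpha> u. (if u < \<alpha> then 1 else 0) * VaR u F) \<in> borel_measurable (?N \<Otimes>\<^sub>M unit_uniform)"
    by measurable
  then have [measurable]: "(\<lambda>\<alpha>. LINT u|unit_uniform. (if u < \<alpha> then 1 else 0) * VaR u F) \<in> borel_measurable ?N"
    by (rule U.borel_measurable_lebesgue_integral)
  have "(\<lambda>\<alpha>. 1 / \<alpha> * (LINT u|unit_uniform. (if u < \<alpha> then 1 else 0) * VaR u F)) \<in> borel_measurable ?N"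
    by measurable
  then show ?thesis
    by (subst measurable_cong[where g="\<lambda>\<alpha>. 1 / \<alpha> * (LINT u|unit_uniform. (if u < \<alpha> then 1 else 0) * VaR u F)"])
       (auto simp: space_restrict_space ES_eq indicator_def intro!: Bochner_Integration.integral_cong)
qed

end

text \<open>At \<alpha> = 1 the first formula would be the minimum of \<open>x\<close> and
  \<open>y\<close>, whose expectation reaches the mean only if the law is bounded above by
  \<open>x\<close>; hence the separate value \<open>y\<close>.\<close>

definition ES_score :: "real \<Rightarrow> real \<Rightarrow> real \<Rightarrow> real" where
  "ES_score \<alpha> x y = (if \<alpha> < 1 then x - max 0 (x - y) / \<alpha> else y)"

lemma measurable_ES_score [measurable]: "ES_score \<alpha> x \<in> borel_measurable borel"
  by (cases "\<alpha> < 1") (simp_all add: ES_score_def [abs_def])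

section \<open>Expected shortfall as the maximal expected score, attained at quantiles\<close>

locale dist_fun_moment = dist_fun +
  assumes finite_first_moment: "finite_first_moment F"
begin

lemma integrable_id: "integrable (interval_measure F) (\<lambda>y. y)"
  using finite_first_moment by (simp add: finite_first_moment_def)

lemma integrable_VaR: "integrable unit_uniform (\<lambda>u. VaR u F)"
  by (rule iffD1[OF integrable_law_iff integrable_id]) measurable

lemma integrable_ES_score: "integrable (interval_measure F) (ES_score \<alpha> x)"
  using integrable_id by (cases "\<alpha> < 1") (simp_all add: ES_score_def [abs_def])

text \<open>Because \<open>{..<\<alpha>}\<close> has mass \<alpha>, the constant \<open>x\<close>
  can be spread over it and joined with \<open>ES\<close>. The integrand \<open>d x\<close> is
  nonnegative, since the positive part of a number dominates both the number and 0. The bound, its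
  attainment and the equality case are then all read off \<open>d x\<close> pointwise.\<close>

lemma ES_minus_score:
  assumes \<alpha>: "\<alpha> \<in> {0<..<1}"
  defines "d \<equiv> \<lambda>x u. max 0 (x - VaR u F) - indicator {..<\<alpha>} u * (x - VaR u F)"
  shows "ES \<alpha> F - (LINT y|interval_measure F. ES_score \<alpha> x y) = (LINT u|unit_uniform. d x u) / \<alpha>"
    and "integrable unit_uniform (d x)"
proof -
  interpret U: prob_space unit_uniform
    by (rule prob_space_unit_uniform)
  have [measurable]: "indicat_real {..<\<alpha>} \<in> borel_measurable unit_uniform"
    by (intro measurable_restrict_space1) simp
  have i1: "integrable unit_uniform (\<lambda>u. max 0 (x - VaR u F))"
    using integrable_VaR by simp
  have i2: "integrable unit_uniform (\<lambda>u. indicator {..<\<alpha>} u * VaR u F)"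
    by (rule Bochner_Integration.integrable_bound[OF integrable_VaR])
       (simp_all split: split_indicator)
  have i3: "integrable unit_uniform (\<lambda>u. indicator {..<\<alpha>} u * x)"
    by (rule U.integrable_const_bound[where B="\<bar>x\<bar>"]) (simp_all split: split_indicator)
  have v3: "(LINT u|unit_uniform. indicator {..<\<alpha>} u * x) = \<alpha> * x"
    using measure_unit_uniform_lessThan[of \<alpha>] \<alpha> by (simp add: space_restrict_space)
  show "integrable unit_uniform (d x)"
    using i1 i2 i3 by (auto simp: d_def right_diff_distrib)
  have "(LINT u|unit_uniform. d x u) =
      (LINT u|unit_uniform. max 0 (x - VaR u F)) - \<alpha> * x
        + (LINT u|unit_uniform. indicator {..<\<alpha>} u * VaR u F)"
    using i1 i2 i3 v3 by (simp add: d_def right_diff_distrib)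
  moreover have "(LINT y|interval_measure F. ES_score \<alpha> x y) =
      x - (LINT u|unit_uniform. max 0 (x - VaR u F)) / \<alpha>"
    using \<alpha> i1 U.prob_space by (subst integral_law) (auto simp: ES_score_def)
  moreover have "ES \<alpha> F = (LINT u|unit_uniform. indicator {..<\<alpha>} u * VaR u F) / \<alpha>"
    using \<alpha> by (simp add: ES_eq)
  ultimately show "ES \<alpha> F - (LINT y|interval_measure F. ES_score \<alpha> x y) =
      (LINT u|unit_uniform. d x u) / \<alpha>"
    using \<alpha> by (simp add: field_simps)
qed

lemma ES_score_le:
  assumes "\<alpha> \<in> {0<..1}"
  shows "(LINT y|interval_measure F. ES_score \<alpha> x y) \<le> ES \<alpha> F"
proof (cases "\<alpha> = 1")
  case True
  then show ?thesis by (simp add: ES_score_def ES_1 mean_def)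
next
  case False
  then have \<alpha>: "\<alpha> \<in> {0<..<1}" using assms by auto
  have "0 \<le> (LINT u|unit_uniform. max 0 (x - VaR u F) - indicator {..<\<alpha>} u * (x - VaR u F))"
    by (intro Bochner_Integration.integral_nonneg) (auto split: split_indicator)
  then have "0 \<le> ES \<alpha> F - (LINT y|interval_measure F. ES_score \<alpha> x y)"
    unfolding ES_minus_score(1)[OF \<alpha>] using \<alpha> by (intro divide_nonneg_pos) auto
  then show ?thesis by simp
qed

text \<open>Only levels other than \<alpha> are tested, which is what the equality case provides. By
  \<open>VaR_le_iff\<close> the two conditions bound \<open>F x\<close> from below by every u <
  \<alpha>, and \<open>F y\<close> for y < x from above by every u > \<alpha>.\<close>

lemma is_quantileI:
  assumes \<alpha>: "\<alpha> \<in> {0<..<1}"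
    and below: "\<And>u. u \<in> {0<..<\<alpha>} \<Longrightarrow> VaR u F \<le> x"
    and above: "\<And>u. u \<in> {\<alpha><..<1} \<Longrightarrow> x \<le> VaR u F"
  shows "is_quantile \<alpha> F x"
proof -
  have "\<alpha> \<le> F x"
  proof (rule dense_le_bounded[of 0])
    fix u assume "0 < u" "u < \<alpha>"
    then show "u \<le> F x" using below[of u] VaR_le_iff[of u x] \<alpha> by auto
  qed (use \<alpha> in auto)
  moreover have "F y \<le> \<alpha>" if "y < x" for y
  proof (rule dense_ge_bounded[of _ 1])
    fix u assume "\<alpha> < u" "u < 1"
    then show "F y \<le> u" using above[of u] VaR_le_iff[of u y] \<alpha> that by auto
  qed (use \<alpha> in auto)
  then have "eventually (\<lambda>y. F y \<le> \<alpha>) (at_left x)"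
    by (auto intro!: eventually_at_leftI[of "x - 1"])
  \<comment> \<open>\<open>Lim\<close> is meaningful only once convergence is known; the left limit
    exists as the mass of \<open>{..<x}\<close>.\<close>
  moreover have "(F \<longlongrightarrow> Lim (at_left x) F) (at_left x)"
    using law.cdf_at_left[of x] tendsto_Lim[of "at_left x" F] by (simp add: cdf_F)
  ultimately show ?thesis
    unfolding is_quantile_def by (auto intro: tendsto_upperbound)
qed

lemma is_quantile_VaR: "\<alpha> \<in> {0<..<1} \<Longrightarrow> is_quantile \<alpha> F (VaR \<alpha> F)"
  by (rule is_quantileI) (auto intro!: VaR_mono)

text \<open>A zero gap makes the nonnegative integrand vanish almost surely, which means that
  \<open>VaR\<close> is at most \<open>x\<close> below \<alpha> and at least \<open>x\<close> above
  it. Monotonicity extends this to every level \<open>u\<close>, by comparison with a good level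
  \<open>v\<close> between \<open>u\<close> and \<alpha>.\<close>

lemma is_quantile_if_ES_score_eq:
  assumes \<alpha>: "\<alpha> \<in> {0<..<1}"
    and eq: "(LINT y|interval_measure F. ES_score \<alpha> x y) = ES \<alpha> F"
  shows "is_quantile \<alpha> F x"
proof (rule is_quantileI[OF \<alpha>])
  let ?d = "\<lambda>u. max 0 (x - VaR u F) - indicator {..<\<alpha>} u * (x - VaR u F)"
  have "(LINT u|unit_uniform. ?d u) = 0"
    using ES_minus_score(1)[OF \<alpha>, of x] eq \<alpha> by simp
  then have AE: "AE u in unit_uniform. ?d u = 0"
    by (subst (asm) integral_nonneg_eq_0_iff_AE[OF ES_minus_score(2)[OF \<alpha>]])
       (auto split: split_indicator)
  { fix u assume u: "u \<in> {0<..<\<alpha>}"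
    obtain v where "v \<in> {u<..<\<alpha>}" "?d v = 0"
      using AE_unit_uniform_Ioo[OF AE, of u \<alpha>] u \<alpha> by auto
    then show "VaR u F \<le> x"
      using VaR_mono[of u v] u \<alpha> by (auto simp: max_def split: if_splits) }
  { fix u assume u: "u \<in> {\<alpha><..<1}"
    obtain v where "v \<in> {\<alpha><..<u}" "?d v = 0"
      using AE_unit_uniform_Ioo[OF AE, of \<alpha> u] u \<alpha> by auto
    then show "x \<le> VaR u F"
      using VaR_mono[of v u] u \<alpha> by (auto simp: max_def split: if_splits) }
qed

lemma ES_score_VaR:
  assumes \<alpha>: "\<alpha> \<in> {0<..<1}"
  shows "(LINT y|interval_measure F. ES_score \<alpha> (VaR \<alpha> F) y) = ES \<alpha> F"
proof -
  \<comment> \<open>At the \<alpha>-quantile the integrand vanishes at every level, by monotonicity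
    of \<open>VaR\<close>.\<close>
  have "(LINT u|unit_uniform. max 0 (VaR \<alpha> F - VaR u F) - indicator {..<\<alpha>} u * (VaR \<alpha> F - VaR u F)) =
      (LINT u|unit_uniform. 0)"
    using VaR_mono \<alpha>
    by (intro Bochner_Integration.integral_cong)
       (auto simp: space_restrict_space max_def split: split_indicator intro: antisym)
  with ES_minus_score(1)[OF \<alpha>, of "VaR \<alpha> F"] show ?thesis by simp
qed

end

text \<open>The left side is the tangent of exp at \<open>z\<close>, evaluated at \<open>G\<close>.
  It increases with \<open>G\<close>, and at \<nu> it does not exceed exp. Equality overall forces
  equality in both steps: the first gives G = \<nu>, the second makes \<nu> the point of
  tangency.\<close>

lemma exp_times_one_plus_le:
  fixes G \<nu> z :: real
  assumes "G \<le> \<nu>"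
  shows "exp z * (1 + G - z) \<le> exp \<nu>"
    and "exp z * (1 + G - z) = exp \<nu> \<Longrightarrow> G = \<nu> \<and> z = \<nu>"
proof -
  have 1: "exp z * (1 + G - z) \<le> exp z * (1 + (\<nu> - z))"
    using assms by simp
  have 2: "exp z * (1 + (\<nu> - z)) \<le> exp z * exp (\<nu> - z)"
    using exp_ge_add_one_self[of "\<nu> - z"] by simp
  have 3: "exp z * exp (\<nu> - z) = exp \<nu>"
    by (simp flip: exp_add)
  show "exp z * (1 + G - z) \<le> exp \<nu>"
    using 1 2 3 by linarith
  assume "exp z * (1 + G - z) = exp \<nu>"
  then have *: "exp z * (1 + G - z) = exp z * (1 + (\<nu> - z))" "exp z * (1 + (\<nu> - z)) = exp z * exp (\<nu> - z)"
    using 1 2 3 by linarith+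
  then have "exp (\<nu> - z) = 1 + (\<nu> - z)" "G = \<nu>"
    by simp_all
  \<comment> \<open>With s = exp (\<nu> - z) the equation reads ln s = s - 1, whose only solution is
    s = 1.\<close>
  moreover from this(1) have "exp (\<nu> - z) = 1"
    using ln_exp[of "\<nu> - z"] by (intro ln_eq_minus_one[OF exp_gt_zero]) linarith
  ultimately show "G = \<nu> \<and> z = \<nu>"
    by simp
qed

section \<open>Supports and atoms of measures\<close>

lemma AE_msupport:
  fixes \<mu> :: "'a::second_countable_topology measure"
  assumes sets: "\<And>U. open U \<Longrightarrow> U \<inter> space \<mu> \<in> sets \<mu>"
  shows "AE x in \<mu>. x \<in> msupport \<mu>"
proof -
  \<comment> \<open>The points outside the support are covered by open sets of measure zero; the
    Lindelof property leaves countably many of them, so their union is still null.\<close>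
  obtain \<U> where \<U>: "\<U> \<subseteq> {U. open U \<and> emeasure \<mu> (U \<inter> space \<mu>) = 0}" "countable \<U>"
    and Un: "\<Union>\<U> = \<Union>{U. open U \<and> emeasure \<mu> (U \<inter> space \<mu>) = 0}"
    by (rule Lindelof[of "{U. open U \<and> emeasure \<mu> (U \<inter> space \<mu>) = 0}"]) auto
  have "(\<Union>U\<in>\<U>. U \<inter> space \<mu>) \<in> null_sets \<mu>"
    using \<U> sets by (intro null_sets_UN') auto
  moreover have "{x \<in> space \<mu>. x \<notin> msupport \<mu>} \<subseteq> (\<Union>U\<in>\<U>. U \<inter> space \<mu>)"
  proof safe
    fix x assume x: "x \<in> space \<mu>" "x \<notin> msupport \<mu>"
    then obtain U where "open U" "x \<in> U" "emeasure \<mu> (U \<inter> space \<mu>) = 0"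
      by (auto simp: msupport_def)
    then have "x \<in> \<Union>\<U>"
      unfolding Un by auto
    with x show "x \<in> (\<Union>U\<in>\<U>. U \<inter> space \<mu>)" by auto
  qed
  ultimately show ?thesis
    by (rule AE_I')
qed

text \<open>Removing the other, finitely many, support points leaves an open neighbourhood
  \<open>U\<close> of \<open>a\<close>. Almost every point is in the support, so \<open>U\<close>
  has the mass of the single point, and this is positive because \<open>a\<close> is in the
  support.\<close>

lemma measure_msupport_atom_pos:
  fixes \<mu> :: "'a::{second_countable_topology, t1_space} measure"
  assumes "finite_measure \<mu>" and sets: "\<And>U. open U \<Longrightarrow> U \<inter> space \<mu> \<in> sets \<mu>"
    and fin: "finite (msupport \<mu>)" and a: "a \<in> msupport \<mu>" "{a} \<in> sets \<mu>"
  shows "measure \<mu> {a} > 0"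
proof -
  interpret finite_measure \<mu> by fact
  define U where "U = - (msupport \<mu> - {a})"
  have U: "open U" "a \<in> U"
    using fin by (auto simp: U_def intro!: finite_imp_closed simp del: Compl_Diff_eq)
  have "AE x in \<mu>. x \<in> U \<inter> space \<mu> \<longleftrightarrow> x \<in> {a}"
    using AE_msupport[OF sets, simplified] AE_space by eventually_elim (auto simp: U_def)
  then have "emeasure \<mu> (U \<inter> space \<mu>) = emeasure \<mu> {a}"
    using sets[OF U(1)] a(2) by (intro emeasure_eq_AE) auto
  moreover have "emeasure \<mu> (U \<inter> space \<mu>) > 0"
    using a(1) U by (auto simp: msupport_def)
  ultimately show ?thesis
    by (simp add: emeasure_eq_measure)
qed

section \<open>Spectral risk as a finite mixture of expected shortfalls\<close>

context
  fixes \<mu> :: "real measure"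
  assumes \<mu>: "spectral_measure \<mu>"
begin

interpretation \<mu>: prob_space \<mu>
  using \<mu> by (simp add: spectral_measure_def)

lemma space_spectral_measure: "space \<mu> = {0..1}"
  and sets_spectral_measure: "sets \<mu> = sets (restrict_space borel {0..1})"
  and msupport_spectral_measure: "msupport \<mu> \<subseteq> {0<..1}"
  using \<mu> by (simp_all add: spectral_measure_def)

lemma open_Int_sets_spectral_measure: "open U \<Longrightarrow> U \<inter> space \<mu> \<in> sets \<mu>"
  by (auto simp: space_spectral_measure sets_spectral_measure sets_restrict_space)

lemma singleton_sets_spectral_measure: "a \<in> {0..1} \<Longrightarrow> {a} \<in> sets \<mu>"
  by (auto simp: sets_spectral_measure sets_restrict_space intro!: image_eqI[of _ _ "{a}"])

text \<open>\<open>S\<close> is any finite set of levels carrying \<mu> almost surely, so one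
  formula serves both \<open>{1}\<close> and the whole support.\<close>

lemma spectral_risk_eq_sum:
  assumes F: "distribution_function F"
    and S: "finite S" "S \<subseteq> {0..1}" and AE: "AE \<alpha> in \<mu>. \<alpha> \<in> S"
  shows "spectral_risk \<mu> F = (\<Sum>a\<in>S. measure \<mu> {a} * ES a F)"
proof -
  interpret dist_fun F by standard (rule F)
  have [measurable]: "(\<lambda>\<alpha>. ES \<alpha> F) \<in> borel_measurable \<mu>"
    using measurable_ES by (simp cong: measurable_cong_sets add: sets_spectral_measure)
  have sets: "\<And>a. a \<in> S \<Longrightarrow> {a} \<in> sets \<mu>"
    using S singleton_sets_spectral_measure by auto
  then have [measurable]: "S \<in> sets \<mu>"
    using sets.finite_UN[of S "\<lambda>a. {a}" \<mu>] S(1) by simp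
  have "spectral_risk \<mu> F = (LINT \<alpha>|\<mu>. ES \<alpha> F * indicator S \<alpha>)"
    unfolding spectral_risk_def using AE by (intro integral_cong_AE) auto
  also have "\<dots> = (\<Sum>a\<in>S. ES a F * measure \<mu> {a})"
    using S(1) sets by (intro integral_indicator_finite_real) (auto simp: less_top[symmetric])
  finally show ?thesis
    by (simp add: mult.commute)
qed

end

section \<open>Elicitability of the mean and of mixtures of expected shortfalls\<close>

lemma (in dist_fun_moment) expectation_mean_score:
  "(LINT y|interval_measure F. x\<^sup>2 - 2 * x * y) = (x - mean F)\<^sup>2 - (mean F)\<^sup>2"
  and integrable_mean_score: "integrable (interval_measure F) (\<lambda>y. x\<^sup>2 - 2 * x * y)"
proof -
  show "integrable (interval_measure F) (\<lambda>y. x\<^sup>2 - 2 * x * y)"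
    using integrable_id
    by (intro Bochner_Integration.integrable_diff integrable_mult_right law.integrable_const) auto
  have "(LINT y|interval_measure F. x\<^sup>2 - 2 * x * y) = x\<^sup>2 - 2 * x * mean F"
    using integrable_id law.prob_space by (subst Bochner_Integration.integral_diff) (simp_all add: mean_def)
  then show "(LINT y|interval_measure F. x\<^sup>2 - 2 * x * y) = (x - mean F)\<^sup>2 - (mean F)\<^sup>2"
    by (simp add: power2_diff)
qed

lemma component_of_elicitable_mean:
  assumes F: "\<And>F. F \<in> \<F> \<Longrightarrow> dist_fun_moment F"
    and \<nu>: "\<And>F. F \<in> \<F> \<Longrightarrow> \<nu> F = mean F"
  shows "component_of_elicitable 1 \<F> \<nu>"
proof -
  define T where "T F = (\<lambda>i\<in>{..<1::nat}. mean F)" for F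
  define S where "S x y = (x 0)\<^sup>2 - 2 * x 0 * y" for x :: "nat \<Rightarrow> real" and y
  have E: "expected_score S x F = (x 0 - mean F)\<^sup>2 - (mean F)\<^sup>2" if "F \<in> \<F>" for x F
    using dist_fun_moment.expectation_mean_score[OF F[OF that]]
    by (simp add: expected_score_def S_def)
  have "scoring_function (Rvec 1) \<F> S"
    unfolding scoring_function_def S_def [abs_def]
    using dist_fun_moment.integrable_mean_score[OF F] by blast
  moreover have "strictly_consistent (Rvec 1) \<F> T S"
    unfolding strictly_consistent_def
  proof (intro ballI conjI impI)
    fix F x assume *: "F \<in> \<F>" "x \<in> Rvec 1"
    show "expected_score S (T F) F \<le> expected_score S x F"
      using * by (simp add: E T_def)
    assume "expected_score S (T F) F = expected_score S x F"
    then have "x 0 = mean F"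
      using * by (simp add: E T_def)
    then show "x = T F"
      using * by (intro PiE_ext[of x "{..<1}" "\<lambda>_. UNIV"]) (auto simp: T_def)
  qed
  ultimately have "elicitable 1 (Rvec 1) \<F> T"
    unfolding elicitable_def by (auto simp: T_def)
  moreover have "\<forall>F\<in>\<F>. T F 0 = \<nu> F"
    using \<nu> by (simp add: T_def)
  ultimately show ?thesis
    unfolding component_of_elicitable_def by blast
qed

text \<open>The expected score splits into a sum of \<open>R\<close> terms and an exponential term,
  each minimal at \<open>T F\<close>. Equal totals therefore force equality in both, and each can
  then be examined component by component.\<close>

lemma component_of_elicitable_ES_mixture:
  fixes q w :: "nat \<Rightarrow> real"
  assumes F: "\<And>F. F \<in> \<F> \<Longrightarrow> dist_fun_moment F" "\<And>F. F \<in> \<F> \<Longrightarrow> unique_quantiles F"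
    and q: "\<And>i. i < L \<Longrightarrow> q i \<in> {0<..1}"
    and w: "\<And>i. i < L \<Longrightarrow> w i > 0"
    and \<nu>: "\<And>F. F \<in> \<F> \<Longrightarrow> \<nu> F = (\<Sum>i<L. w i * ES (q i) F)"
  shows "component_of_elicitable (1 + L) \<F> \<nu>"
proof -
  define \<tau> where "\<tau> i F = (if q i < 1 then VaR (q i) F else mean F)" for i F
  define T where "T F = (\<lambda>i\<in>{..<1 + L}. if i < L then \<tau> i F else \<nu> F)" for F
  \<comment> \<open>At level 1 \<open>ES_score\<close> does not depend on its action argument, so
    only \<open>m\<close> can pin down that component; below level 1 \<open>ES_score\<close> does so
    itself.\<close>
  define m where "m i t y = (if q i < 1 then 0 else t\<^sup>2 - 2 * t * y)" for i and t y :: real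
  define S where "S x y =
      (\<Sum>i<L. m i (x i) y) - exp (x L) * (1 + (\<Sum>i<L. w i * ES_score (q i) (x i) y) - x L)"
    for x :: "nat \<Rightarrow> real" and y
  define R where "R i t F = (if q i < 1 then 0 else (t - mean F)\<^sup>2 - (mean F)\<^sup>2)" for i t F
  define V where "V i t F = (LINT y|interval_measure F. ES_score (q i) t y)" for i t F
  have S: "integrable (interval_measure F) (S x)"
    "expected_score S x F = (\<Sum>i<L. R i (x i) F) - exp (x L) * (1 + (\<Sum>i<L. w i * V i (x i) F) - x L)"
    if "F \<in> \<F>" for x F
  proof -
    interpret dist_fun_moment F using F(1)[OF that] .
    have m: "integrable (interval_measure F) (m i t)"
      "(LINT y|interval_measure F. m i t y) = R i t F" for i t
      using integrable_mean_score[of t] expectation_mean_score[of t]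
      by (cases "q i < 1"; simp add: m_def [abs_def] R_def)+
    have g: "integrable (interval_measure F) (\<lambda>y. \<Sum>i<L. w i * ES_score (q i) (x i) y)"
      using integrable_ES_score by (intro Bochner_Integration.integrable_sum integrable_mult_right) auto
    have G: "(LINT y|interval_measure F. (\<Sum>i<L. w i * ES_score (q i) (x i) y)) = (\<Sum>i<L. w i * V i (x i) F)"
      using integrable_ES_score by (subst Bochner_Integration.integral_sum) (simp_all add: V_def)
    have M: "integrable (interval_measure F) (\<lambda>y. \<Sum>i<L. m i (x i) y)"
      "(LINT y|interval_measure F. (\<Sum>i<L. m i (x i) y)) = (\<Sum>i<L. R i (x i) F)"
      using m by (auto simp: Bochner_Integration.integral_sum)
    \<comment> \<open>\<open>has_bochner_integral\<close> yields integrability and the value of the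
      integral in one derivation.\<close>
    have h: "has_bochner_integral (interval_measure F) (S x)
      ((\<Sum>i<L. R i (x i) F) - exp (x L) * (1 + (\<Sum>i<L. w i * V i (x i) F) - x L))"
      unfolding S_def [abs_def]
      using g G M law.prob_space
      by (intro has_bochner_integral_diff has_bochner_integral_mult_right has_bochner_integral_add)
         (auto simp: has_bochner_integral_iff)
    show "integrable (interval_measure F) (S x)"
      "expected_score S x F = (\<Sum>i<L. R i (x i) F) - exp (x L) * (1 + (\<Sum>i<L. w i * V i (x i) F) - x L)"
      using h by (simp_all add: has_bochner_integral_iff expected_score_def)
  qed
  have "scoring_function (Rvec (1 + L)) \<F> S"
    unfolding scoring_function_def using S(1) by blast
  moreover have "strictly_consistent (Rvec (1 + L)) \<F> T S"
    unfolding strictly_consistent_def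
  proof (intro ballI conjI impI)
    fix F x assume *: "F \<in> \<F>" "x \<in> Rvec (1 + L)"
    interpret dist_fun_moment F using F(1)[OF *(1)] .
    have q01: "q i \<in> {0<..<1}" if "i < L" "q i < 1" for i
      using q[OF that(1)] that by auto
    have V_le: "w i * V i t F \<le> w i * ES (q i) F" if "i < L" for i t
      using ES_score_le[OF q[OF that]] w[OF that] by (simp add: V_def)
    have V_T: "V i (\<tau> i F) F = ES (q i) F" if "i < L" for i
      using ES_score_VaR[OF q01[OF that]] q[OF that] ES_1
      by (cases "q i < 1") (auto simp: V_def \<tau>_def ES_score_def mean_def)
    have R_le: "R i (\<tau> i F) F \<le> R i t F" for i t
      by (simp add: R_def \<tau>_def)
    define G where "G = (\<Sum>i<L. w i * V i (x i) F)"
    have G_le: "G \<le> \<nu> F"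
      unfolding G_def \<nu>[OF *(1)] using V_le by (intro sum_mono) auto
    have RT_le: "(\<Sum>i<L. R i (\<tau> i F) F) \<le> (\<Sum>i<L. R i (x i) F)"
      using R_le by (intro sum_mono) auto
    \<comment> \<open>At \<open>T F\<close> each \<open>V\<close> equals the expected shortfall, so
      the inner sum and the last component are both \<nu> F, and the factor 1 + \<nu> F - \<nu> F
      collapses to 1.\<close>
    have ST: "expected_score S (T F) F = (\<Sum>i<L. R i (\<tau> i F) F) - exp (\<nu> F)"
      using V_T by (simp add: S(2)[OF *(1)] T_def \<nu>[OF *(1)])
    have Sx: "expected_score S x F = (\<Sum>i<L. R i (x i) F) - exp (x L) * (1 + G - x L)"
      by (simp add: S(2)[OF *(1)] G_def)
    show "expected_score S (T F) F \<le> expected_score S x F"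
      using RT_le exp_times_one_plus_le(1)[OF G_le, of "x L"] unfolding ST Sx by linarith
    assume "expected_score S (T F) F = expected_score S x F"
    then have "(\<Sum>i<L. R i (\<tau> i F) F) = (\<Sum>i<L. R i (x i) F)" "exp (x L) * (1 + G - x L) = exp (\<nu> F)"
      using RT_le exp_times_one_plus_le(1)[OF G_le, of "x L"] unfolding ST Sx by linarith+
    then have R_eq: "\<And>i. i < L \<Longrightarrow> R i (\<tau> i F) F = R i (x i) F" and eq: "G = \<nu> F" "x L = \<nu> F"
      using sum_mono_inv[of "\<lambda>i. R i (\<tau> i F) F" "{..<L}" "\<lambda>i. R i (x i) F"] R_le
        exp_times_one_plus_le(2)[OF G_le, of "x L"] by auto
    \<comment> \<open>The weighted sum attains its termwise bound, hence so does each term;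
      positivity of \<open>w i\<close> lets the weight be cancelled.\<close>
    have V_eq: "V i (x i) F = ES (q i) F" if "i < L" for i
      using sum_mono_inv[of "\<lambda>i. w i * V i (x i) F" "{..<L}" "\<lambda>i. w i * ES (q i) F" i]
        V_le eq(1) w[OF that] that unfolding G_def \<nu>[OF *(1)] by auto
    have "x i = \<tau> i F" if i: "i < L" for i
    proof (cases "q i < 1")
      case True
      \<comment> \<open>Both \<open>x i\<close> and \<open>VaR (q i) F\<close> are quantiles at
        level \<open>q i\<close>, so uniqueness identifies them.\<close>
      have "is_quantile (q i) F (x i)"
        using is_quantile_if_ES_score_eq[OF q01[OF i True]] V_eq[OF i] by (simp add: V_def)
      with is_quantile_VaR[OF q01[OF i True]] F(2)[OF *(1)] q01[OF i True] True
      show ?thesis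
        unfolding unique_quantiles_def \<tau>_def by (metis (full_types))
    next
      case False
      with R_eq[OF i] show ?thesis by (simp add: R_def \<tau>_def)
    qed
    with eq(2) have "x i = T F i" if "i < 1 + L" for i
      using that by (auto simp: T_def less_Suc_eq)
    then show "x = T F"
      using * by (intro PiE_ext[of x "{..<1 + L}" "\<lambda>_. UNIV"]) (auto simp: T_def)
  qed
  ultimately have "elicitable (1 + L) (Rvec (1 + L)) \<F> T"
    unfolding elicitable_def by (auto simp: T_def)
  moreover have "\<forall>F\<in>\<F>. T F L = \<nu> F"
    by (simp add: T_def)
  ultimately show ?thesis
    unfolding component_of_elicitable_def by (metis less_add_one add.commute)
qed

theorem corollary5p4:
  fixes \<F> :: "(real \<Rightarrow> real) set" and \<mu> :: "real measure" and L :: nat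
  assumes "\<And>F. F \<in> \<F> \<Longrightarrow> distribution_function F"
    and "\<And>F. F \<in> \<F> \<Longrightarrow> finite_first_moment F"
    and "\<And>F. F \<in> \<F> \<Longrightarrow> unique_quantiles F"
    and "spectral_measure \<mu>"
    and "finite (msupport \<mu>)" and "card (msupport \<mu>) = L"
  shows "(measure \<mu> {1} = 1 \<longrightarrow> component_of_elicitable 1 \<F> (spectral_risk \<mu>)) \<and>
         (measure \<mu> {1} < 1 \<longrightarrow> component_of_elicitable (1 + L) \<F> (spectral_risk \<mu>))"
proof (intro conjI impI)
  interpret \<mu>: prob_space \<mu>
    using assms(4) by (simp add: spectral_measure_def)
  have moment: "dist_fun_moment F" if "F \<in> \<F>" for F
    using assms(1,2)[OF that] by unfold_locales
  have supp: "msupport \<mu> \<subseteq> {0<..1}"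
    using msupport_spectral_measure[OF assms(4)] .
  {
    assume 1: "measure \<mu> {1} = 1"
    have "spectral_risk \<mu> F = mean F" if "F \<in> \<F>" for F
    proof -
      interpret dist_fun_moment F using moment[OF that] .
      \<comment> \<open>Full mass at 1 leaves a sum with one term, which \<open>ES_1\<close>
        identifies as the mean.\<close>
      show ?thesis
        using spectral_risk_eq_sum[OF assms(4) distribution_function, of "{1}"]
          \<mu>.AE_prob_1[OF 1] 1 ES_1 by simp
    qed
    then show "component_of_elicitable 1 \<F> (spectral_risk \<mu>)"
      using component_of_elicitable_mean moment by blast
  next
    \<comment> \<open>An enumeration of the support provides the levels; the weights will be the
      masses of its points.\<close>
    obtain q where "bij_betw q {0..<L} (msupport \<mu>)"
      using ex_bij_betw_nat_finite[OF assms(5)] assms(6) by auto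
    then have q: "bij_betw q {..<L} (msupport \<mu>)"
      by (simp add: lessThan_atLeast0)
    show "component_of_elicitable (1 + L) \<F> (spectral_risk \<mu>)"
    proof (rule component_of_elicitable_ES_mixture[OF moment assms(3)])
      fix i assume "i < L"
      then have qi: "q i \<in> msupport \<mu>"
        using q by (auto simp: bij_betw_def)
      with supp show "q i \<in> {0<..1}" by auto
      then show "measure \<mu> {q i} > 0"
        using \<mu>.finite_measure_axioms open_Int_sets_spectral_measure[OF assms(4)] assms(5) qi
          singleton_sets_spectral_measure[OF assms(4), of "q i"]
        by (intro measure_msupport_atom_pos) auto
    next
      fix F assume "F \<in> \<F>"
      have "spectral_risk \<mu> F = (\<Sum>a\<in>msupport \<mu>. measure \<mu> {a} * ES a F)"
        using supp open_Int_sets_spectral_measure[OF assms(4)]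
        by (intro spectral_risk_eq_sum[OF assms(4) assms(1)[OF \<open>F \<in> \<F>\<close>] assms(5)] AE_msupport) auto
      also have "\<dots> = (\<Sum>i<L. measure \<mu> {q i} * ES (q i) F)"
        by (rule sum.reindex_bij_betw[OF q, symmetric])
      finally show "spectral_risk \<mu> F = (\<Sum>i<L. measure \<mu> {q i} * ES (q i) F)" .
    qed
  }
qed

end
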